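(* Let $Q$ be an ltt left quasigroup and $\alpha$ a congruence of $Q$. Then (1) $\alpha$ is abelian if and only if the subgroup $\mathrm{Dis}_\alpha$ is abelian and it acts $\alpha$-semiregularly on $Q$; (2) $\alpha$ is central if and only if the subgroup $\mathrm{Dis}_\alpha$ is central in $\mathrm{Dis}(Q)$ and $\mathrm{Dis}(Q)$ acts $\alpha$-semiregularly on $Q$.
   Context: A left quasigroup is a nonempty set $Q$ with two binary operations $*,\backslash$ satisfying $x\backslash(x*y)=y=x*(x\backslash y)$. Write $L_a(b)=a*b$; this is a permutation of $Q$ with $L_a^{-1}(b)=a\backslash b$. Let $\mathrm{LMlt}(Q)=\langle L_a: a\in Q\rangle\le \mathrm{Sym}(Q)$; it and its subgroups act naturally on $Q$. A congruence of $Q$ is an equivalence relation on $Q$ compatible with both $*$ and $\backslash$. Left translation terms (lt-terms): an lt-term is a term in the language $\{*,\backslash\}$ of the form $s_1(x_{i_1})\circ_1(s_2(x_{i_2})\circ_2(\cdots(s_{m-1}(x_{i_{m-1}})\circ_{m-1}s_m(x_{i_m}))\cdots))$, where each $\circ_j\in\{*,\backslash\}$ and each $s_j$ is a unary term (a term in one variable). A left quasigroup $Q$ is called ltt if every term function on $Q$ (in the language $\{*,\backslash\}$) results from some lt-term. Displacement groups: the displacement group of $Q$ is $\mathrm{Dis}(Q)=\langle L_aL_b^{-1}: a,b\in Q\rangle$, the subgroup of $\mathrm{LMlt}(Q)$ generated by all $L_aL_b^{-1}$. For a congruence $\alpha$ of $Q$, the displacement group relative to $\alpha$, $\mathrm{Dis}_\alpha$,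 is the smallest normal subgroup of $\mathrm{LMlt}(Q)$ containing all $L_aL_b^{-1}$ with $a\,\alpha\,b$, that is, $\mathrm{Dis}_\alpha=\langle fL_aL_b^{-1}f^{-1}: a\,\alpha\,b,\ f\in\mathrm{LMlt}(Q)\rangle$. Semiregularity: if $\alpha$ is an equivalence on a set $X$ and a group $G$ acts on $X$, the action is $\alpha$-semiregular if for every $g\in G$ and $a\in X$, $g(a)=a$ implies $g(b)=b$ for every $b\,\alpha\,a$. Abelian and central congruences: for congruences $\alpha,\beta,\delta$ of an algebraic structure $A$, $C(\alpha,\beta;\delta)$ means: for every $(n+1)$-ary term operation $t$ of $A$, every pair $a\,\alpha\,b$ and all $u_1\,\beta\,v_1,\dots,u_n\,\beta\,v_n$, $t(a,u_1,\dots,u_n)\,\delta\,t(a,v_1,\dots,v_n)$ implies $t(b,u_1,\dots,u_n)\,\delta\,t(b,v_1,\dots,v_n)$. Let $0_A$ be the equality relation on $A$ and $1_A=A\times A$. A congruence $\alpha$ of $A$ is abelian if $C(\alpha,\alpha;0_A)$ and central if $C(\alpha,1_A;0_A)$. Here $A=Q$, with terms built from both $*$ and $\backslash$.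
   Formalization: In (2), Dis(Q) is taken to be the normal subgroup of LMlt(Q) generated by all L_aL_b^{-1} (that is, Dis_α for α = 1_Q), not the plain subgroup they generate; with the plain subgroup, (2) fails for a 5-element ltt left quasigroup. The two agree whenever the plain one is normal. *)

theory Defs
  imports "HOL-Algebra.Generated_Groups" "HOL-Algebra.Bij"
begin

section \<open>Left quasigroups and their terms\<close>

record 'a lquasigroup = "'a partial_object" +
  lmul :: "['a, 'a] \<Rightarrow> 'a"
  ldiv :: "['a, 'a] \<Rightarrow> 'a"

locale left_quasigroup =
  fixes Q :: "('a, 'b) lquasigroup_scheme"
  assumes nonempty: "carrier Q \<noteq> {}"
    and lmul_closed: "\<lbrakk>x \<in> carrier Q; y \<in> carrier Q\<rbrakk> \<Longrightarrow> lmul Q x y \<in> carrier Q"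
    and ldiv_closed: "\<lbrakk>x \<in> carrier Q; y \<in> carrier Q\<rbrakk> \<Longrightarrow> ldiv Q x y \<in> carrier Q"
    and ldiv_lmul: "\<lbrakk>x \<in> carrier Q; y \<in> carrier Q\<rbrakk> \<Longrightarrow> ldiv Q x (lmul Q x y) = y"
    and lmul_ldiv: "\<lbrakk>x \<in> carrier Q; y \<in> carrier Q\<rbrakk> \<Longrightarrow> lmul Q x (ldiv Q x y) = y"

datatype lq_term = Var nat | Mul lq_term lq_term | Div lq_term lq_term

primrec vars :: "lq_term \<Rightarrow> nat set" where
  "vars (Var i) = {i}"
| "vars (Mul s t) = vars s \<union> vars t"
| "vars (Div s t) = vars s \<union> vars t"

primrec eval :: "('a, 'b) lquasigroup_scheme \<Rightarrow> (nat \<Rightarrow> 'a) \<Rightarrow> lq_term \<Rightarrow> 'a" where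
  "eval Q \<rho> (Var i) = \<rho> i"
| "eval Q \<rho> (Mul s t) = lmul Q (eval Q \<rho> s) (eval Q \<rho> t)"
| "eval Q \<rho> (Div s t) = ldiv Q (eval Q \<rho> s) (eval Q \<rho> t)"

text \<open>A term of the form $s(x_i)$ with $s$ unary is a term whose only variable is $x_i$.\<close>

inductive lt_term :: "lq_term \<Rightarrow> bool" where
  lt_unary: "vars s = {i} \<Longrightarrow> lt_term s"
| lt_Mul: "\<lbrakk>vars s = {i}; lt_term t\<rbrakk> \<Longrightarrow> lt_term (Mul s t)"
| lt_Div: "\<lbrakk>vars s = {i}; lt_term t\<rbrakk> \<Longrightarrow> lt_term (Div s t)"

text \<open>An $n$-ary term has its variables among $x_0,\dots,x_{n-1}$.\<close>

definition ltt :: "('a, 'b) lquasigroup_scheme \<Rightarrow> bool" where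
  "ltt Q \<longleftrightarrow> (\<forall>n t. vars t \<subseteq> {..<n} \<longrightarrow>
     (\<exists>s. lt_term s \<and> vars s \<subseteq> {..<n} \<and>
       (\<forall>\<rho>. (\<forall>i<n. \<rho> i \<in> carrier Q) \<longrightarrow> eval Q \<rho> t = eval Q \<rho> s)))"

section \<open>Congruences and the term condition\<close>

definition congruence :: "('a, 'b) lquasigroup_scheme \<Rightarrow> ('a \<times> 'a) set \<Rightarrow> bool" where
  "congruence Q \<alpha> \<longleftrightarrow> equiv (carrier Q) \<alpha> \<and>
     (\<forall>a b c d. (a, b) \<in> \<alpha> \<longrightarrow> (c, d) \<in> \<alpha> \<longrightarrow>
       (lmul Q a c, lmul Q b d) \<in> \<alpha> \<and> (ldiv Q a c, ldiv Q b d) \<in> \<alpha>)"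

text \<open>In an $(n+1)$-ary term, $x_0$ is the distinguished variable and $x_{i+1}$ takes the
  value $u_i$; \<open>case_nat a u\<close> is the corresponding assignment.\<close>

definition centralizes ::
  "('a, 'b) lquasigroup_scheme \<Rightarrow> ('a \<times> 'a) set \<Rightarrow> ('a \<times> 'a) set \<Rightarrow> ('a \<times> 'a) set \<Rightarrow> bool" where
  "centralizes Q \<alpha> \<beta> \<delta> \<longleftrightarrow>
     (\<forall>n t a b u v. vars t \<subseteq> {..n} \<longrightarrow> (a, b) \<in> \<alpha> \<longrightarrow> (\<forall>i<n. (u i, v i) \<in> \<beta>) \<longrightarrow>
       (eval Q (case_nat a u) t, eval Q (case_nat a v) t) \<in> \<delta> \<longrightarrow>
       (eval Q (case_nat b u) t, eval Q (case_nat b v) t) \<in> \<delta>)"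

definition abelian_congruence :: "('a, 'b) lquasigroup_scheme \<Rightarrow> ('a \<times> 'a) set \<Rightarrow> bool" where
  "abelian_congruence Q \<alpha> \<longleftrightarrow> centralizes Q \<alpha> \<alpha> (Id_on (carrier Q))"

definition central_congruence :: "('a, 'b) lquasigroup_scheme \<Rightarrow> ('a \<times> 'a) set \<Rightarrow> bool" where
  "central_congruence Q \<alpha> \<longleftrightarrow>
     centralizes Q \<alpha> (carrier Q \<times> carrier Q) (Id_on (carrier Q))"

section \<open>Displacement groups\<close>

text \<open>Subgroups of $\mathrm{Sym}(Q)$ are given by their sets of elements, which are extensional
  functions, as required by \<^const>\<open>BijGroup\<close>.\<close>

abbreviation Sym :: "('a, 'b) lquasigroup_scheme \<Rightarrow> ('a \<Rightarrow> 'a) monoid" where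
  "Sym Q \<equiv> BijGroup (carrier Q)"

abbreviation subgroup_of :: "('a, 'b) monoid_scheme \<Rightarrow> 'a set \<Rightarrow> ('a, 'b) monoid_scheme" where
  "subgroup_of G H \<equiv> G\<lparr>carrier := H\<rparr>"

definition L :: "('a, 'b) lquasigroup_scheme \<Rightarrow> 'a \<Rightarrow> 'a \<Rightarrow> 'a" where
  "L Q a = (\<lambda>b\<in>carrier Q. lmul Q a b)"

definition LMlt :: "('a, 'b) lquasigroup_scheme \<Rightarrow> ('a \<Rightarrow> 'a) set" where
  "LMlt Q = generate (Sym Q) (L Q ` carrier Q)"

definition Dis_rel :: "('a, 'b) lquasigroup_scheme \<Rightarrow> ('a \<times> 'a) set \<Rightarrow> ('a \<Rightarrow> 'a) set" where
  "Dis_rel Q \<alpha> = generate (Sym Q)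
     {f \<otimes>\<^bsub>Sym Q\<^esub> (L Q a \<otimes>\<^bsub>Sym Q\<^esub> inv\<^bsub>Sym Q\<^esub> (L Q b)) \<otimes>\<^bsub>Sym Q\<^esub> inv\<^bsub>Sym Q\<^esub> f
       | f a b. f \<in> LMlt Q \<and> (a, b) \<in> \<alpha>}"

definition Dis_gen :: "('a, 'b) lquasigroup_scheme \<Rightarrow> ('a \<Rightarrow> 'a) set" where
  "Dis_gen Q = generate (Sym Q)
     {L Q a \<otimes>\<^bsub>Sym Q\<^esub> inv\<^bsub>Sym Q\<^esub> (L Q b) | a b. a \<in> carrier Q \<and> b \<in> carrier Q}"

text \<open>The displacement group is the one relative to the full congruence, that is, the subgroup of
  $\mathrm{LMlt}(Q)$ generated by all $L_aL_b^{-1}$ \<^emph>\<open>as a normal subgroup\<close>. In the literature it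
  is often written as the plain subgroup \<^const>\<open>Dis_gen\<close>. For racks that subgroup is normal, and then
  the two agree (lemma \<open>Dis_eq_Dis_gen\<close> below), but for ltt left quasigroups it need not be
  normal, and the characterization of central congruences fails for it. For instance, on
  $\{1,\dots,5\}$ put $g=(1\,2\,3\,4)$, $f_2=(1\,2)$, $f_1=gf_2$ and let $L_1=\dots=L_4=f_1$,
  $L_5=f_2$. This is ltt, since $L_{x*y}=L_{x\backslash y}=L_y$. The congruence $\alpha$ with
  classes $\{1,2,3,4\}$ and $\{5\}$ has trivial relative displacement group, and the plain
  subgroup $\langle g\rangle$ acts $\alpha$-semiregularly, yet $\alpha$ is not central:
  for $t(x,u)=u*(u*x)$ one has $t(2,5)=2=t(2,1)$ but $t(1,5)=1\neq 4=t(1,1)$.\<close>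

definition Dis :: "('a, 'b) lquasigroup_scheme \<Rightarrow> ('a \<Rightarrow> 'a) set" where
  "Dis Q = Dis_rel Q (carrier Q \<times> carrier Q)"

definition semiregular ::
  "('x \<times> 'x) set \<Rightarrow> ('g, 'm) monoid_scheme \<Rightarrow> 'x set \<Rightarrow> ('g \<Rightarrow> 'x \<Rightarrow> 'x) \<Rightarrow> bool" where
  "semiregular \<alpha> G X \<phi> \<longleftrightarrow>
     (\<forall>g\<in>carrier G. \<forall>a\<in>X. \<phi> g a = a \<longrightarrow> (\<forall>b. (b, a) \<in> \<alpha> \<longrightarrow> \<phi> g b = b))"

definition group_center :: "('g, 'm) monoid_scheme \<Rightarrow> 'g set" where
  "group_center G = {z \<in> carrier G. \<forall>g\<in>carrier G. z \<otimes>\<^bsub>G\<^esub> g = g \<otimes>\<^bsub>G\<^esub> z}"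

section \<open>Basic facts\<close>

context left_quasigroup
begin

lemma L_in_Sym: "a \<in> carrier Q \<Longrightarrow> L Q a \<in> carrier (Sym Q)"
proof -
  assume a: "a \<in> carrier Q"
  have "bij_betw (L Q a) (carrier Q) (carrier Q)"
    by (rule bij_betw_byWitness[where f' = "ldiv Q a"])
       (auto simp: L_def a ldiv_lmul lmul_ldiv lmul_closed ldiv_closed)
  then show ?thesis by (simp add: BijGroup_def Bij_def L_def)
qed

lemma subgroup_LMlt: "subgroup (LMlt Q) (Sym Q)"
  unfolding LMlt_def
  by (rule group.generate_is_subgroup[OF group_BijGroup]) (auto intro: L_in_Sym)

lemma Dis_eq_Dis_gen:
  assumes N: "Dis_gen Q \<lhd> subgroup_of (Sym Q) (LMlt Q)"
  shows "Dis Q = Dis_gen Q"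
proof
  interpret S: group "Sym Q" by (rule group_BijGroup)
  let ?D = "{L Q a \<otimes>\<^bsub>Sym Q\<^esub> inv\<^bsub>Sym Q\<^esub> (L Q b) | a b. a \<in> carrier Q \<and> b \<in> carrier Q}"
  have D: "?D \<subseteq> carrier (Sym Q)" by (auto intro: L_in_Sym)
  then have sg: "subgroup (Dis_gen Q) (Sym Q)"
    unfolding Dis_gen_def by (rule S.generate_is_subgroup)
  have conj: "f \<otimes>\<^bsub>Sym Q\<^esub> d \<otimes>\<^bsub>Sym Q\<^esub> inv\<^bsub>Sym Q\<^esub> f \<in> Dis_gen Q"
    if "f \<in> LMlt Q" "d \<in> Dis_gen Q" for f d
    using normal.inv_op_closed2[OF N, of f d] that S.m_inv_consistent[OF subgroup_LMlt, of f]
    by simp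
  show "Dis Q \<subseteq> Dis_gen Q"
    unfolding Dis_def Dis_rel_def
  proof (rule S.generate_subgroup_incl[OF _ sg], safe)
    fix f a b assume "f \<in> LMlt Q" "a \<in> carrier Q" "b \<in> carrier Q"
    then show "f \<otimes>\<^bsub>Sym Q\<^esub> (L Q a \<otimes>\<^bsub>Sym Q\<^esub> inv\<^bsub>Sym Q\<^esub> (L Q b)) \<otimes>\<^bsub>Sym Q\<^esub> inv\<^bsub>Sym Q\<^esub> f \<in> Dis_gen Q"
      by (intro conj) (auto simp: Dis_gen_def intro!: generate.incl)
  qed
  show "Dis_gen Q \<subseteq> Dis Q"
    unfolding Dis_gen_def Dis_def Dis_rel_def
  proof (rule S.mono_generate, safe)
    fix a b assume ab: "a \<in> carrier Q" "b \<in> carrier Q"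
    have "L Q a \<otimes>\<^bsub>Sym Q\<^esub> inv\<^bsub>Sym Q\<^esub> (L Q b) \<in> carrier (Sym Q)"
      using ab by (auto intro: L_in_Sym)
    then have "L Q a \<otimes>\<^bsub>Sym Q\<^esub> inv\<^bsub>Sym Q\<^esub> (L Q b) =
      \<one>\<^bsub>Sym Q\<^esub> \<otimes>\<^bsub>Sym Q\<^esub> (L Q a \<otimes>\<^bsub>Sym Q\<^esub> inv\<^bsub>Sym Q\<^esub> (L Q b)) \<otimes>\<^bsub>Sym Q\<^esub> inv\<^bsub>Sym Q\<^esub> \<one>\<^bsub>Sym Q\<^esub>"
      by simp
    moreover have "\<one>\<^bsub>Sym Q\<^esub> \<in> LMlt Q" by (rule subgroup.one_closed[OF subgroup_LMlt])
    ultimately show "\<exists>f a' b'. L Q a \<otimes>\<^bsub>Sym Q\<^esub> inv\<^bsub>Sym Q\<^esub> (L Q b) =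
      f \<otimes>\<^bsub>Sym Q\<^esub> (L Q a' \<otimes>\<^bsub>Sym Q\<^esub> inv\<^bsub>Sym Q\<^esub> (L Q b')) \<otimes>\<^bsub>Sym Q\<^esub> inv\<^bsub>Sym Q\<^esub> f \<and>
      f \<in> LMlt Q \<and> (a', b') \<in> carrier Q \<times> carrier Q"
      using ab by blast
  qed
qed

end

end

theory Submission
  imports Defs
begin

text \<open>
  Both parts are instances of one equivalence for a pair of congruences $\alpha,\beta$ of an ltt left
  quasigroup (\<open>centralizes_iff\<close>): $C(\alpha,\beta;0_Q)$ holds if and only if
  $\mathrm{Dis}_\alpha$ and $\mathrm{Dis}_\beta$ commute elementwise and $\mathrm{Dis}_\beta$ acts
  $\alpha$-semiregularly. Part (1) is $\beta=\alpha$, part (2) is $\beta=1_Q$, for which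
  $\mathrm{Dis}_\beta=\mathrm{Dis}(Q)$.

  From left to right, an element $g$ of $\mathrm{Dis}_\beta$ is a polynomial map $x\mapsto t(x,u)$ for
  which some $v$ with $u\,\beta\,v$ makes $x\mapsto t(x,v)$ the identity: in a conjugate of
  $L_uL_v^{-1}$ replace the parameter $u$ by $v$. Hence the term condition can compare $g$ with the identity.
  Applied to $t(x,u)$ itself it gives semiregularity. Applied to $x\backslash g(x*y)$, composed
  with the inverse of $L_b^{-1}gL_b$, it gives $L_a^{-1}gL_a=L_b^{-1}gL_b$ for $a\,\alpha\,b$, so
  $g$ commutes with $L_aL_b^{-1}$; since $\mathrm{Dis}_\beta$ is invariant under conjugation, it
  commutes with all of $\mathrm{Dis}_\alpha$. To avoid handling terms with many parameters, this
  is carried out in the subalgebra of $Q^4$ of all quadruples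
  $(t(a,u),t(a,v),t(b,u),t(b,v))$, called \<open>rect\<close> (\<open>rect_term\<close>, \<open>rect_Dis_rel\<close>).

  From right to left, an lt-term in $x_0,\dots,x_n$ evaluates to $F(e)$, where $F$ is a product of
  translations by values of unary terms, or inverses of such, and $e$ is the value of a unary term.
  Each unary term sees either the distinguished variable or a parameter, but never both; this is where the
  ltt hypothesis enters. Let $F_{au},F_{av},F_{bu},F_{bv}$ be the four values of $F$. For a single factor
  the quotients $F_{av}^{-1}F_{au}$ and $F_{bv}^{-1}F_{bu}$ clearly agree and lie in
  $\mathrm{Dis}_\beta$, and commuting makes this property multiplicative (\<open>parallel_mult\<close>). Call
  the common quotient $g$. Then $t(a,u)=t(a,v)$ says that $g$ maps $e_{au}$ to $e_{av}$, and the goal is that it maps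
  $e_{bu}$ to $e_{bv}$. If $e$ depends on a parameter, then these are the same statement. If
  $e$ depends on the distinguished variable, then $g$ fixes $e_{au}$ and the goal is that it fixes the
  $\alpha$-related element $e_{bu}$, which is semiregularity.
\<close>

section \<open>Evaluation of terms\<close>

lemma eval_cong_vars:
  assumes "\<And>i. i \<in> vars t \<Longrightarrow> \<rho> i = \<sigma> i"
  shows "eval Q \<rho> t = eval Q \<sigma> t"
  using assms by (induction t) auto

lemma eval_related:
  assumes "congruence Q \<theta>" and "\<And>i. i \<in> vars t \<Longrightarrow> (\<rho> i, \<sigma> i) \<in> \<theta>"
  shows "(eval Q \<rho> t, eval Q \<sigma> t) \<in> \<theta>"
  using assms(2) by (induction t) (use assms(1) in \<open>auto simp: congruence_def\<close>)

lemma congruence_subset: "congruence Q \<theta> \<Longrightarrow> \<theta> \<subseteq> carrier Q \<times> carrier Q"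
  unfolding congruence_def by (blast dest: equiv_type)

lemma congruence_refl: "congruence Q \<theta> \<Longrightarrow> x \<in> carrier Q \<Longrightarrow> (x, x) \<in> \<theta>"
  unfolding congruence_def by (meson equivE refl_onD)

lemma congruence_sym: "congruence Q \<theta> \<Longrightarrow> (x, y) \<in> \<theta> \<Longrightarrow> (y, x) \<in> \<theta>"
  unfolding congruence_def by (meson equivE symD)

lemma semiregularD:
  "semiregular \<alpha> G X \<phi> \<Longrightarrow> g \<in> carrier G \<Longrightarrow> a \<in> X \<Longrightarrow> \<phi> g a = a \<Longrightarrow> (b, a) \<in> \<alpha> \<Longrightarrow> \<phi> g b = b"
  unfolding semiregular_def by blast

section \<open>The subalgebra of term matrices\<close>

text \<open>The quadruple \<open>p q r s\<close> stands for the matrix with rows \<open>p q\<close> and \<open>r s\<close>: the distinguished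
  variable is $a$ in the top row and $b$ in the bottom row, and the parameters are $u$ in the left column
  and $v$ in the right column. These matrices form the subalgebra of $Q^4$ generated by the
  matrices of the variables.\<close>

inductive rect ::
  "('a, 'b) lquasigroup_scheme \<Rightarrow> ('a \<times> 'a) set \<Rightarrow> 'a \<Rightarrow> 'a \<Rightarrow> 'a \<Rightarrow> 'a \<Rightarrow> 'a \<Rightarrow> 'a \<Rightarrow> bool"
  for Q \<beta> a b where
  base: "rect Q \<beta> a b a a b b"
| param: "(u, v) \<in> \<beta> \<Longrightarrow> rect Q \<beta> a b u v u v"
| lmul: "rect Q \<beta> a b p q r s \<Longrightarrow> rect Q \<beta> a b p' q' r' s' \<Longrightarrow>
    rect Q \<beta> a b (lmul Q p p') (lmul Q q q') (lmul Q r r') (lmul Q s s')"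
| ldiv: "rect Q \<beta> a b p q r s \<Longrightarrow> rect Q \<beta> a b p' q' r' s' \<Longrightarrow>
    rect Q \<beta> a b (ldiv Q p p') (ldiv Q q q') (ldiv Q r r') (ldiv Q s s')"

text \<open>A term with its parameters that witnesses membership in \<open>rect\<close>. Only the parameters with index in
  $[k,m)$, which are the variables $x_{k+1},\dots,x_m$, may occur in \<open>t\<close>; witnesses with adjacent
  ranges can therefore be joined without renaming variables.\<close>

definition rect_by ::
  "('a, 'b) lquasigroup_scheme \<Rightarrow> ('a \<times> 'a) set \<Rightarrow> 'a \<Rightarrow> 'a \<Rightarrow> 'a \<Rightarrow> 'a \<Rightarrow> 'a \<Rightarrow> 'a \<Rightarrow>
     nat \<Rightarrow> nat \<Rightarrow> lq_term \<Rightarrow> (nat \<Rightarrow> 'a) \<Rightarrow> (nat \<Rightarrow> 'a) \<Rightarrow> bool" where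
  "rect_by Q \<beta> a b p q r s k m t u v \<longleftrightarrow> k \<le> m \<and> vars t \<subseteq> insert 0 {k<..m} \<and>
     (\<forall>i. k \<le> i \<longrightarrow> i < m \<longrightarrow> (u i, v i) \<in> \<beta>) \<and>
     eval Q (case_nat a u) t = p \<and> eval Q (case_nat a v) t = q \<and>
     eval Q (case_nat b u) t = r \<and> eval Q (case_nat b v) t = s"

lemma rect_by_combine:
  assumes 1: "rect_by Q \<beta> a b p q r s k m t u v"
    and 2: "rect_by Q \<beta> a b p' q' r' s' m m' t' u' v'"
    and c: "(c = Mul \<and> d = lmul Q) \<or> (c = Div \<and> d = ldiv Q)"
  shows "\<exists>m t u v. rect_by Q \<beta> a b (d p p') (d q q') (d r r') (d s s') k m t u v"
proof -
  define w where "w = (\<lambda>i. if i < m then u i else u' i)"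
  define z where "z = (\<lambda>i. if i < m then v i else v' i)"
  have "eval Q (case_nat x w) t = eval Q (case_nat x u) t \<and>
        eval Q (case_nat x z) t = eval Q (case_nat x v) t" for x
    using 1 by (intro conjI; intro eval_cong_vars)
       (auto simp: rect_by_def w_def z_def split: nat.split)
  moreover have "eval Q (case_nat x w) t' = eval Q (case_nat x u') t' \<and>
        eval Q (case_nat x z) t' = eval Q (case_nat x v') t'" for x
    using 2 by (intro conjI; intro eval_cong_vars)
       (auto simp: rect_by_def w_def z_def split: nat.split)
  moreover have "k \<le> m'" "vars t \<union> vars t' \<subseteq> insert 0 {k<..m'}"
    using 1 2 by (force simp: rect_by_def)+
  moreover have "\<forall>i. k \<le> i \<longrightarrow> i < m' \<longrightarrow> (w i, z i) \<in> \<beta>"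
    using 1 2 by (auto simp: rect_by_def w_def z_def)
  ultimately have "rect_by Q \<beta> a b (d p p') (d q q') (d r r') (d s s') k m' (c t t') w z"
    using 1 2 c unfolding rect_by_def by (elim disjE conjE) simp_all
  then show ?thesis by blast
qed

text \<open>The free choice of the first index \<open>k\<close> is what lets the induction place the parameters of the second
  factor after those of the first one.\<close>

lemma rect_term:
  assumes "rect Q \<beta> a b p q r s"
  shows "\<exists>m t u v. rect_by Q \<beta> a b p q r s k m t u v"
  using assms
proof (induction arbitrary: k)
  case base
  have "rect_by Q \<beta> a b a a b b k k (Var 0) (\<lambda>_. a) (\<lambda>_. a)" by (simp add: rect_by_def)
  then show ?case by blast
next
  case (param u v)
  then have "rect_by Q \<beta> a b u v u v k (Suc k) (Var (Suc k)) (\<lambda>_. u) (\<lambda>_. v)"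
    by (simp add: rect_by_def)
  then show ?case by blast
next
  case (lmul p q r s p' q' r' s')
  obtain m t u v where 1: "rect_by Q \<beta> a b p q r s k m t u v"
    using lmul.IH(1) by blast
  obtain m' t' u' v' where 2: "rect_by Q \<beta> a b p' q' r' s' m m' t' u' v'"
    using lmul.IH(2) by blast
  show ?case by (rule rect_by_combine[OF 1 2, where c = Mul]) simp
next
  case (ldiv p q r s p' q' r' s')
  obtain m t u v where 1: "rect_by Q \<beta> a b p q r s k m t u v"
    using ldiv.IH(1) by blast
  obtain m' t' u' v' where 2: "rect_by Q \<beta> a b p' q' r' s' m m' t' u' v'"
    using ldiv.IH(2) by blast
  show ?case by (rule rect_by_combine[OF 1 2, where c = Div]) simp
qed

section \<open>The symmetric group on the carrier\<close>

context group
begin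

lemma inv_cancel_left [simp]:
  "x \<in> carrier G \<Longrightarrow> y \<in> carrier G \<Longrightarrow> inv x \<otimes> (x \<otimes> y) = y"
  "x \<in> carrier G \<Longrightarrow> y \<in> carrier G \<Longrightarrow> x \<otimes> (inv x \<otimes> y) = y"
  by (simp_all flip: m_assoc)

lemma commute_generate:
  assumes "f \<in> generate G X" "X \<subseteq> carrier G" "g \<in> carrier G"
    and "\<And>x. x \<in> X \<Longrightarrow> x \<otimes> g = g \<otimes> x"
  shows "f \<otimes> g = g \<otimes> f"
  using assms(1)
proof induction
  case (inv h)
  then have h: "h \<in> carrier G" "h \<otimes> g = g \<otimes> h" using assms by auto
  have "inv h \<otimes> (h \<otimes> g) \<otimes> inv h = inv h \<otimes> (g \<otimes> h) \<otimes> inv h" using h by simp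
  then show ?case using h(1) assms(3) by (simp add: m_assoc)
next
  case (eng h1 h2)
  then have h: "h1 \<in> carrier G" "h2 \<in> carrier G"
    using generate_in_carrier[OF assms(2)] by auto
  have "h1 \<otimes> h2 \<otimes> g = h1 \<otimes> (g \<otimes> h2)" using eng.IH h assms(3) by (simp add: m_assoc)
  also have "\<dots> = (g \<otimes> h1) \<otimes> h2"
    using h assms(3) by (simp flip: m_assoc eng.IH(1))
  also have "\<dots> = g \<otimes> (h1 \<otimes> h2)" using h assms(3) by (simp add: m_assoc)
  finally show ?case .
qed (use assms in auto)

end

context left_quasigroup
begin

interpretation Sym: group "Sym Q" by (rule group_BijGroup)

abbreviation comp_Sym (infixl "\<odot>" 70) where "f \<odot> g \<equiv> f \<otimes>\<^bsub>Sym Q\<^esub> g"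
abbreviation inv_Sym where "inv_Sym f \<equiv> inv\<^bsub>Sym Q\<^esub> f"

lemma Sym_apply: "f \<in> carrier (Sym Q) \<Longrightarrow> x \<in> carrier Q \<Longrightarrow> f x \<in> carrier Q"
  by (auto simp: BijGroup_def Bij_def bij_betw_def)

lemma Sym_mult_apply:
  "f \<in> carrier (Sym Q) \<Longrightarrow> g \<in> carrier (Sym Q) \<Longrightarrow> x \<in> carrier Q \<Longrightarrow> (f \<odot> g) x = f (g x)"
  by (simp add: BijGroup_def compose_def)

lemma Sym_one_apply: "x \<in> carrier Q \<Longrightarrow> \<one>\<^bsub>Sym Q\<^esub> x = x"
  by (simp add: BijGroup_def)

lemma Sym_inv_apply:
  assumes "f \<in> carrier (Sym Q)" "x \<in> carrier Q"
  shows "inv_Sym f (f x) = x" "f (inv_Sym f x) = x"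
  using assms Sym_mult_apply[of "inv_Sym f" f x] Sym_mult_apply[of f "inv_Sym f" x]
  by (simp_all add: Sym_one_apply)

lemma Sym_injD:
  "f \<in> carrier (Sym Q) \<Longrightarrow> f x = f y \<Longrightarrow> x \<in> carrier Q \<Longrightarrow> y \<in> carrier Q \<Longrightarrow> x = y"
  by (auto simp: BijGroup_def Bij_def bij_betw_def inj_on_def)

lemma Sym_eqI:
  assumes "f \<in> carrier (Sym Q)" "g \<in> carrier (Sym Q)" "\<And>x. x \<in> carrier Q \<Longrightarrow> f x = g x"
  shows "f = g"
  using assms by (auto simp: BijGroup_def Bij_def intro: extensionalityI)

lemma L_apply: "x \<in> carrier Q \<Longrightarrow> L Q a x = lmul Q a x"
  by (simp add: L_def)

lemma inv_L_apply:
  assumes "a \<in> carrier Q" "x \<in> carrier Q"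
  shows "inv_Sym (L Q a) x = ldiv Q a x"
proof -
  have "inv_Sym (L Q a) (L Q a (ldiv Q a x)) = ldiv Q a x"
    using assms by (intro Sym_inv_apply L_in_Sym ldiv_closed)
  then show ?thesis using assms by (simp add: L_apply ldiv_closed lmul_ldiv)
qed

section \<open>Relative displacement groups\<close>

lemma LMlt_carrier: "f \<in> LMlt Q \<Longrightarrow> f \<in> carrier (Sym Q)"
  using subgroup.mem_carrier[OF subgroup_LMlt] .

lemma L_in_LMlt: "a \<in> carrier Q \<Longrightarrow> L Q a \<in> LMlt Q"
  unfolding LMlt_def by (auto intro: generate.incl)

lemmas LMlt_mult = subgroup.m_closed[OF subgroup_LMlt]
  and LMlt_inv = subgroup.m_inv_closed[OF subgroup_LMlt]
  and LMlt_one = subgroup.one_closed[OF subgroup_LMlt]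

abbreviation Dis_conjugates where
  "Dis_conjugates \<theta> \<equiv> {f \<odot> (L Q a \<odot> inv_Sym (L Q b)) \<odot> inv_Sym f | f a b. f \<in> LMlt Q \<and> (a, b) \<in> \<theta>}"

context
  fixes \<theta>
  assumes sub: "\<theta> \<subseteq> carrier Q \<times> carrier Q"
begin

lemma Dis_conjugates_carrier: "Dis_conjugates \<theta> \<subseteq> carrier (Sym Q)"
proof safe
  fix f a b assume "f \<in> LMlt Q" "(a, b) \<in> \<theta>"
  moreover from this sub have "a \<in> carrier Q" "b \<in> carrier Q" by auto
  ultimately show "f \<odot> (L Q a \<odot> inv_Sym (L Q b)) \<odot> inv_Sym f \<in> carrier (Sym Q)"
    by (simp add: L_in_Sym LMlt_carrier)
qed

lemma subgroup_Dis_rel: "subgroup (Dis_rel Q \<theta>) (Sym Q)"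
  unfolding Dis_rel_def by (rule Sym.generate_is_subgroup[OF Dis_conjugates_carrier])

lemma Dis_rel_carrier: "g \<in> Dis_rel Q \<theta> \<Longrightarrow> g \<in> carrier (Sym Q)"
  using subgroup.mem_carrier[OF subgroup_Dis_rel] .

lemmas Dis_rel_mult = subgroup.m_closed[OF subgroup_Dis_rel]
  and Dis_rel_inv = subgroup.m_inv_closed[OF subgroup_Dis_rel]
  and Dis_rel_one = subgroup.one_closed[OF subgroup_Dis_rel]

text \<open>The generators are closed under conjugation by \<open>LMlt Q\<close>, hence so is the group they generate.\<close>

lemma Dis_rel_conj:
  assumes "h \<in> LMlt Q" "g \<in> Dis_rel Q \<theta>"
  shows "h \<odot> g \<odot> inv_Sym h \<in> Dis_rel Q \<theta>"
proof -
  have conj: "h \<odot> g \<odot> inv_Sym h \<in> Dis_conjugates \<theta>" if g: "g \<in> Dis_conjugates \<theta>" for g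
  proof -
    obtain f a b where fab: "g = f \<odot> (L Q a \<odot> inv_Sym (L Q b)) \<odot> inv_Sym f" "f \<in> LMlt Q" "(a, b) \<in> \<theta>"
      using g by blast
    moreover have "a \<in> carrier Q" "b \<in> carrier Q" using fab sub by auto
    ultimately have "h \<odot> g \<odot> inv_Sym h = (h \<odot> f) \<odot> (L Q a \<odot> inv_Sym (L Q b)) \<odot> inv_Sym (h \<odot> f)"
      using assms(1) by (simp add: LMlt_carrier L_in_Sym Sym.m_assoc Sym.inv_mult_group)
    then show ?thesis using fab LMlt_mult assms(1) by blast
  qed
  note hS = LMlt_carrier[OF assms(1)]
  show ?thesis
    using assms(2) unfolding Dis_rel_def
  proof induction
    case one
    then show ?case using hS by (auto intro: generate.one)
  next
    case (incl g)
    show ?case using conj[OF incl] by (rule generate.incl)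
  next
    case (inv g)
    have "g \<in> carrier (Sym Q)" using inv Dis_conjugates_carrier by blast
    then have "h \<odot> inv_Sym g \<odot> inv_Sym h = inv_Sym (h \<odot> g \<odot> inv_Sym h)"
      using hS by (simp add: Sym.m_assoc Sym.inv_mult_group)
    then show ?case using generate.inv[OF conj[OF inv]] by simp
  next
    case (eng g1 g2)
    then have "g1 \<in> carrier (Sym Q)" "g2 \<in> carrier (Sym Q)"
      using Sym.generate_in_carrier[OF Dis_conjugates_carrier] by auto
    then have "h \<odot> (g1 \<odot> g2) \<odot> inv_Sym h = (h \<odot> g1 \<odot> inv_Sym h) \<odot> (h \<odot> g2 \<odot> inv_Sym h)"
      using hS by (simp add: Sym.m_assoc)
    then show ?case using eng generate.eng by fastforce
  qed
qed

lemma Dis_rel_conj_inv: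
  assumes "h \<in> LMlt Q" "g \<in> Dis_rel Q \<theta>"
  shows "inv_Sym h \<odot> g \<odot> h \<in> Dis_rel Q \<theta>"
  using Dis_rel_conj[OF LMlt_inv[OF assms(1)] assms(2)] LMlt_carrier[OF assms(1)] by simp

lemma Dis_rel_quotient:
  assumes "(a, b) \<in> \<theta>"
  shows "L Q a \<odot> inv_Sym (L Q b) \<in> Dis_rel Q \<theta>"
proof -
  have ab: "a \<in> carrier Q" "b \<in> carrier Q" using assms sub by auto
  have "\<one>\<^bsub>Sym Q\<^esub> \<odot> (L Q a \<odot> inv_Sym (L Q b)) \<odot> inv_Sym \<one>\<^bsub>Sym Q\<^esub> \<in> Dis_conjugates \<theta>"
    using assms LMlt_one by blast
  then show ?thesis using ab unfolding Dis_rel_def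
    by (intro generate.incl) (simp add: L_in_Sym)
qed

lemma Dis_rel_quotient_inv:
  assumes "(a, b) \<in> \<theta>"
  shows "inv_Sym (L Q b) \<odot> L Q a \<in> Dis_rel Q \<theta>"
proof -
  have ab: "a \<in> carrier Q" "b \<in> carrier Q" using assms sub by auto
  show ?thesis
    using Dis_rel_conj_inv[OF L_in_LMlt[OF ab(2)] Dis_rel_quotient[OF assms]] ab
    by (simp add: L_in_Sym Sym.m_assoc)
qed

end

section \<open>Centrality gives commuting and semiregularity\<close>

lemma centralizesD:
  assumes "centralizes Q \<alpha> \<beta> \<delta>" "vars t \<subseteq> {..n}" "(a, b) \<in> \<alpha>" "\<forall>i<n. (u i, v i) \<in> \<beta>"
    and "(eval Q (case_nat a u) t, eval Q (case_nat a v) t) \<in> \<delta>"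
  shows "(eval Q (case_nat b u) t, eval Q (case_nat b v) t) \<in> \<delta>"
  by (rule assms(1)[unfolded centralizes_def, THEN spec[of _ n], THEN spec[of _ t],
        THEN spec[of _ a], THEN spec[of _ b], THEN spec[of _ u], THEN spec[of _ v],
        THEN mp, THEN mp, THEN mp, THEN mp, OF assms(2-)])

text \<open>The term condition in the form in which it is used: a matrix with a constant top row has
  a constant bottom row.\<close>

lemma centralizes_rect:
  assumes "centralizes Q \<alpha> \<beta> (Id_on (carrier Q))" "(a, b) \<in> \<alpha>"
    and "rect Q \<beta> a b p p r s" "p \<in> carrier Q"
  shows "r = s"
proof -
  obtain n t u v where "rect_by Q \<beta> a b p p r s 0 n t u v"
    using rect_term[OF assms(3)] by blast
  then have t: "vars t \<subseteq> {..n}" "\<forall>i<n. (u i, v i) \<in> \<beta>"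
    "eval Q (case_nat a u) t = p" "eval Q (case_nat a v) t = p"
    "eval Q (case_nat b u) t = r" "eval Q (case_nat b v) t = s"
    by (auto simp: rect_by_def)
  have "(eval Q (case_nat a u) t, eval Q (case_nat a v) t) \<in> Id_on (carrier Q)"
    using t assms(4) by (auto intro: Id_onI)
  then have "(eval Q (case_nat b u) t, eval Q (case_nat b v) t) \<in> Id_on (carrier Q)"
    by (rule centralizesD[OF assms(1) t(1) assms(2) t(2)])
  then show ?thesis using t by auto
qed

context
  fixes \<beta> a b
  assumes \<beta>: "congruence Q \<beta>" and ab: "a \<in> carrier Q" "b \<in> carrier Q"
begin

lemma rect_carrier:
  assumes "rect Q \<beta> a b p q r s"
  shows "p \<in> carrier Q \<and> q \<in> carrier Q \<and> r \<in> carrier Q \<and> s \<in> carrier Q"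
  using assms by induction (use ab congruence_subset[OF \<beta>] in \<open>auto intro: lmul_closed ldiv_closed\<close>)

lemma rect_const: "x \<in> carrier Q \<Longrightarrow> rect Q \<beta> a b x x x x"
  by (intro rect.param congruence_refl[OF \<beta>])

text \<open>Elements of \<open>LMlt Q\<close> are words in translations by constants, and constants are parameters because
  $\beta$ is reflexive.\<close>

lemma rect_LMlt:
  assumes "f \<in> LMlt Q" "rect Q \<beta> a b p q r s"
  shows "rect Q \<beta> a b (f p) (f q) (f r) (f s)"
  using assms unfolding LMlt_def
proof (induction arbitrary: p q r s)
  case one
  then show ?case using rect_carrier by (simp add: Sym_one_apply)
next
  case (incl f)
  then obtain c where c: "c \<in> carrier Q" "f = L Q c" by auto
  then show ?case
    using rect_carrier[OF incl(2)] rect.lmul[OF rect_const[OF c(1)] incl(2)] by (simp add: L_apply)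
next
  case (inv f)
  then obtain c where c: "c \<in> carrier Q" "f = L Q c" by auto
  then show ?case
    using rect_carrier[OF inv(2)] rect.ldiv[OF rect_const[OF c(1)] inv(2)] by (simp add: inv_L_apply)
next
  case (eng f g)
  then have "f \<in> carrier (Sym Q)" "g \<in> carrier (Sym Q)"
    using LMlt_carrier unfolding LMlt_def by auto
  then show ?case
    using eng rect_carrier[OF eng.prems] by (simp add: Sym_mult_apply)
qed

text \<open>Elements of $\mathrm{Dis}_\beta$ act on the left column alone: replacing $u$ by $v$ in a conjugate
  of $L_uL_v^{-1}$ produces the identity, and that is what acts on the right column.\<close>

lemma rect_Dis_rel:
  assumes "g \<in> Dis_rel Q \<beta>" "rect Q \<beta> a b p q r s"
  shows "rect Q \<beta> a b (g p) q (g r) s"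
proof -
  note sub = congruence_subset[OF \<beta>]
  have quot: "rect Q \<beta> a b (g p) q (g r) s"
    if g: "g = f \<odot> (L Q u \<odot> inv_Sym (L Q v)) \<odot> inv_Sym f" "f \<in> LMlt Q" "(u, v) \<in> \<beta>"
      and R: "rect Q \<beta> a b p q r s" for g f u v p q r s
  proof -
    have uv: "u \<in> carrier Q" "v \<in> carrier Q" using g sub by auto
    note f = LMlt_carrier[OF g(2)]
    note C = rect_carrier[OF R]
    define h where "h = inv_Sym f"
    have h: "h \<in> carrier (Sym Q)" using f by (simp add: h_def)
    have "rect Q \<beta> a b (h p) (h q) (h r) (h s)"
      unfolding h_def by (rule rect_LMlt[OF LMlt_inv[OF g(2)] R])
    from rect.ldiv[OF rect_const[OF uv(2)] this]
    have "rect Q \<beta> a b (ldiv Q v (h p)) (ldiv Q v (h q)) (ldiv Q v (h r)) (ldiv Q v (h s))" .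
    \<comment> \<open>The parameter \<open>(u, v)\<close> multiplies by \<open>u\<close> on the left and by \<open>v\<close> on the right, so the division
      by \<open>v\<close> is undone in the right column only.\<close>
    from rect_LMlt[OF g(2) rect.lmul[OF rect.param[OF g(3)] this]]
    have "rect Q \<beta> a b (f (lmul Q u (ldiv Q v (h p)))) (f (lmul Q v (ldiv Q v (h q))))
        (f (lmul Q u (ldiv Q v (h r)))) (f (lmul Q v (ldiv Q v (h s))))" .
    moreover have "f (lmul Q v (ldiv Q v (h x))) = x" if "x \<in> carrier Q" for x
      using that uv f h by (simp add: lmul_ldiv Sym_apply) (simp add: h_def Sym_inv_apply)
    moreover have "g x = f (lmul Q u (ldiv Q v (h x)))" if "x \<in> carrier Q" for x
      using that uv f h unfolding g(1) h_def
      by (simp add: Sym_mult_apply L_in_Sym Sym_apply inv_L_apply L_apply ldiv_closed)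
    ultimately show ?thesis using C by simp
  qed
  show ?thesis using assms unfolding Dis_rel_def
  proof (induction arbitrary: p q r s)
    case one
    then show ?case using rect_carrier by (simp add: Sym_one_apply)
  next
    case (incl g)
    then obtain f u v where
      "g = f \<odot> (L Q u \<odot> inv_Sym (L Q v)) \<odot> inv_Sym f" "f \<in> LMlt Q" "(u, v) \<in> \<beta>" by blast
    then show ?case by (rule quot[OF _ _ _ incl(2)])
  next
    case (inv g)
    then obtain f u v where
      g: "g = f \<odot> (L Q u \<odot> inv_Sym (L Q v)) \<odot> inv_Sym f" "f \<in> LMlt Q" "(u, v) \<in> \<beta>" by blast
    moreover have "u \<in> carrier Q" "v \<in> carrier Q" using g sub by auto
    ultimately have "inv_Sym g = f \<odot> (L Q v \<odot> inv_Sym (L Q u)) \<odot> inv_Sym f"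
      by (simp add: LMlt_carrier L_in_Sym Sym.m_assoc Sym.inv_mult_group)
    then show ?case by (rule quot[OF _ g(2) congruence_sym[OF \<beta> g(3)] inv(2)])
  next
    case (eng g1 g2)
    then have "g1 \<in> carrier (Sym Q)" "g2 \<in> carrier (Sym Q)"
      using Dis_rel_carrier[OF sub] unfolding Dis_rel_def by auto
    then show ?case
      using eng rect_carrier[OF eng.prems] by (simp add: Sym_mult_apply)
  qed
qed

end

lemma centralizes_imp_semiregular:
  assumes "congruence Q \<alpha>" "congruence Q \<beta>" "centralizes Q \<alpha> \<beta> (Id_on (carrier Q))"
  shows "semiregular \<alpha> (subgroup_of (Sym Q) (Dis_rel Q \<beta>)) (carrier Q) (\<lambda>g. g)"
  unfolding semiregular_def
proof (intro ballI impI allI)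
  fix g a b
  assume "g \<in> carrier (subgroup_of (Sym Q) (Dis_rel Q \<beta>))" and a: "a \<in> carrier Q" "g a = a"
    and ba: "(b, a) \<in> \<alpha>"
  then have g: "g \<in> Dis_rel Q \<beta>" by simp
  have b: "b \<in> carrier Q" using ba congruence_subset[OF assms(1)] by auto
  have "rect Q \<beta> a b (g a) a (g b) b"
    using rect_Dis_rel[OF assms(2) a(1) b g rect.base] .
  then show "g b = b"
    using centralizes_rect[OF assms(3) congruence_sym[OF assms(1) ba]] a by simp
qed

text \<open>For a generator $fL_aL_b^{-1}f^{-1}$ of $\mathrm{Dis}_\alpha$ the claim reduces to
  $L_aL_b^{-1}$ by conjugating $g$ with $f^{-1}$, and there it says that $L_a^{-1}gL_a=L_b^{-1}gL_b$.\<close>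

lemma centralizes_imp_commute:
  assumes "congruence Q \<alpha>" "congruence Q \<beta>" "centralizes Q \<alpha> \<beta> (Id_on (carrier Q))"
    and "f \<in> Dis_rel Q \<alpha>" "g \<in> Dis_rel Q \<beta>"
  shows "f \<odot> g = g \<odot> f"
proof -
  note sub\<alpha> = congruence_subset[OF assms(1)] and sub\<beta> = congruence_subset[OF assms(2)]
  have quot: "L Q a \<odot> inv_Sym (L Q b) \<odot> g = g \<odot> (L Q a \<odot> inv_Sym (L Q b))"
    if g: "g \<in> Dis_rel Q \<beta>" and ab: "(a, b) \<in> \<alpha>" for g a b
  proof -
    have c: "a \<in> carrier Q" "b \<in> carrier Q" using ab sub\<alpha> by auto
    note gS = Dis_rel_carrier[OF sub\<beta> g]
    define h where "h = inv_Sym (L Q b) \<odot> g \<odot> L Q b"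
    have h: "h \<in> Dis_rel Q \<beta>" unfolding h_def by (intro Dis_rel_conj_inv sub\<beta> L_in_LMlt c g)
    note hS = Dis_rel_carrier[OF sub\<beta> h]
    have h_apply: "h y = ldiv Q b (g (lmul Q b y))" if "y \<in> carrier Q" for y
      using that c gS unfolding h_def
      by (simp add: Sym_mult_apply L_in_Sym Sym_apply inv_L_apply L_apply lmul_closed)
    \<comment> \<open>The claim says that conjugating \<open>g\<close> by the two translations gives the same result.\<close>
    have "inv_Sym (L Q a) \<odot> g \<odot> L Q a = h"
    proof (rule Sym_eqI)
      fix y assume y: "y \<in> carrier Q"
      let ?R = "rect Q \<beta> b a"
      \<comment> \<open>The rectangles compute \<open>y \<mapsto> x\(g (x * y))\<close> with \<open>x = b\<close> in the top row and \<open>x = a\<close> in the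
        bottom row; in the right column \<open>g\<close> is replaced by the identity.\<close>
      have "?R (lmul Q b y) (lmul Q b y) (lmul Q a y) (lmul Q a y)"
        by (intro rect.lmul rect.base rect_const assms(2) y c)
      from rect_Dis_rel[OF assms(2) c(2,1) g this]
      have "?R (g (lmul Q b y)) (lmul Q b y) (g (lmul Q a y)) (lmul Q a y)" .
      from rect.ldiv[OF rect.base this]
      have "?R (ldiv Q b (g (lmul Q b y))) (ldiv Q b (lmul Q b y))
          (ldiv Q a (g (lmul Q a y))) (ldiv Q a (lmul Q a y))" .
      then have "?R (h y) y (ldiv Q a (g (lmul Q a y))) y"
        using y c by (simp add: ldiv_lmul h_apply)
      \<comment> \<open>Applying the inverse of \<open>h\<close> makes the top row constant, which is what the term condition
        needs in order to say something about the bottom row.\<close>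
      from rect_Dis_rel[OF assms(2) c(2,1) Dis_rel_inv[OF sub\<beta> h] this]
      have "?R (inv_Sym h (h y)) y (inv_Sym h (ldiv Q a (g (lmul Q a y)))) y" .
      then have "?R y y (inv_Sym h (ldiv Q a (g (lmul Q a y)))) y"
        using Sym_inv_apply(1)[OF hS y] by simp
      then have "inv_Sym h (ldiv Q a (g (lmul Q a y))) = y"
        using centralizes_rect[OF assms(3) congruence_sym[OF assms(1) ab]] y by blast
      moreover have "ldiv Q a (g (lmul Q a y)) \<in> carrier Q"
        using y c gS by (simp add: lmul_closed ldiv_closed Sym_apply)
      ultimately have "ldiv Q a (g (lmul Q a y)) = h y" using Sym_inv_apply(2)[OF hS] by metis
      then show "(inv_Sym (L Q a) \<odot> g \<odot> L Q a) y = h y"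
        using y c gS by (simp add: Sym_mult_apply L_in_Sym Sym_apply inv_L_apply L_apply lmul_closed)
    qed (use c gS hS in \<open>auto simp: L_in_Sym\<close>)
    then have "L Q a \<odot> (inv_Sym (L Q a) \<odot> g \<odot> L Q a) \<odot> inv_Sym (L Q b) =
        L Q a \<odot> (inv_Sym (L Q b) \<odot> g \<odot> L Q b) \<odot> inv_Sym (L Q b)"
      unfolding h_def by simp
    then show ?thesis using c gS by (simp add: L_in_Sym Sym.m_assoc)
  qed
  note gS = Dis_rel_carrier[OF sub\<beta> assms(5)]
  show ?thesis
  proof (rule Sym.commute_generate[OF assms(4)[unfolded Dis_rel_def] Dis_conjugates_carrier[OF sub\<alpha>] gS])
    fix x assume "x \<in> Dis_conjugates \<alpha>"
    then obtain f a b where x: "x = f \<odot> (L Q a \<odot> inv_Sym (L Q b)) \<odot> inv_Sym f"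
      and f: "f \<in> LMlt Q" and ab: "(a, b) \<in> \<alpha>" by blast
    have c: "a \<in> carrier Q" "b \<in> carrier Q" using ab sub\<alpha> by auto
    let ?d = "L Q a \<odot> inv_Sym (L Q b)"
    have "?d \<odot> (inv_Sym f \<odot> g \<odot> f) = (inv_Sym f \<odot> g \<odot> f) \<odot> ?d"
      using quot[OF Dis_rel_conj_inv[OF sub\<beta> f assms(5)] ab] .
    then have "f \<odot> (?d \<odot> (inv_Sym f \<odot> g \<odot> f)) \<odot> inv_Sym f =
        f \<odot> ((inv_Sym f \<odot> g \<odot> f) \<odot> ?d) \<odot> inv_Sym f" by simp
    then show "x \<odot> g = g \<odot> x"
      using c gS LMlt_carrier[OF f] unfolding x by (simp add: L_in_Sym Sym.m_assoc)
  qed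
qed

section \<open>Commuting and semiregularity give centrality\<close>

text \<open>The four values of a product of translations, arranged as in \<open>rect\<close>: both rows have the same
  quotient, which lies in $\mathrm{Dis}_\beta$. The condition on the right column is what makes the
  property multiplicative: it allows commuting the row quotient past a column quotient.\<close>

definition parallel where
  "parallel \<alpha> \<beta> p q r s \<longleftrightarrow> p \<in> LMlt Q \<and> q \<in> LMlt Q \<and> r \<in> LMlt Q \<and> s \<in> LMlt Q \<and>
     inv_Sym q \<odot> p \<in> Dis_rel Q \<beta> \<and> q \<odot> inv_Sym s \<in> Dis_rel Q \<alpha> \<and>
     inv_Sym q \<odot> p = inv_Sym s \<odot> r"

text \<open>The row quotient $d$ of the left factors enters that of the product as $q'^{-1}dq'$ in the top row
  and as $s'^{-1}ds'$ in the bottom row. These agree because $q's'^{-1}\in\mathrm{Dis}_\alpha$ commutes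
  with $d\in\mathrm{Dis}_\beta$.\<close>

lemma parallel_mult:
  assumes sub: "\<alpha> \<subseteq> carrier Q \<times> carrier Q" "\<beta> \<subseteq> carrier Q \<times> carrier Q"
    and comm: "\<And>f g. f \<in> Dis_rel Q \<alpha> \<Longrightarrow> g \<in> Dis_rel Q \<beta> \<Longrightarrow> f \<odot> g = g \<odot> f"
    and 1: "parallel \<alpha> \<beta> p q r s" and 2: "parallel \<alpha> \<beta> p' q' r' s'"
  shows "parallel \<alpha> \<beta> (p \<odot> p') (q \<odot> q') (r \<odot> r') (s \<odot> s')"
proof -
  note LM = 1[unfolded parallel_def] 2[unfolded parallel_def]
  have S: "p \<in> carrier (Sym Q)" "q \<in> carrier (Sym Q)" "r \<in> carrier (Sym Q)" "s \<in> carrier (Sym Q)"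
    "p' \<in> carrier (Sym Q)" "q' \<in> carrier (Sym Q)" "r' \<in> carrier (Sym Q)" "s' \<in> carrier (Sym Q)"
    using LM LMlt_carrier by auto
  define d where "d = inv_Sym q \<odot> p"
  have d: "d \<in> Dis_rel Q \<beta>" "d = inv_Sym s \<odot> r" using LM by (auto simp: d_def)
  note dS = Dis_rel_carrier[OF sub(2) d(1)]
  have pq: "inv_Sym (q \<odot> q') \<odot> (p \<odot> p') = (inv_Sym q' \<odot> d \<odot> q') \<odot> (inv_Sym q' \<odot> p')"
    using S by (simp add: d_def Sym.m_assoc Sym.inv_mult_group)
  have rs: "inv_Sym (s \<odot> s') \<odot> (r \<odot> r') = (inv_Sym s' \<odot> d \<odot> s') \<odot> (inv_Sym s' \<odot> r')"
    using S by (simp add: d(2) Sym.m_assoc Sym.inv_mult_group)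
  have "(q' \<odot> inv_Sym s') \<odot> d = d \<odot> (q' \<odot> inv_Sym s')" using comm d LM by blast
  then have "inv_Sym q' \<odot> ((q' \<odot> inv_Sym s') \<odot> d) \<odot> s' = inv_Sym q' \<odot> (d \<odot> (q' \<odot> inv_Sym s')) \<odot> s'"
    by simp
  then have "inv_Sym s' \<odot> d \<odot> s' = inv_Sym q' \<odot> d \<odot> q'"
    using S dS by (simp add: Sym.m_assoc)
  then have "inv_Sym (q \<odot> q') \<odot> (p \<odot> p') = inv_Sym (s \<odot> s') \<odot> (r \<odot> r')"
    using LM pq rs by simp
  moreover have "inv_Sym (q \<odot> q') \<odot> (p \<odot> p') \<in> Dis_rel Q \<beta>"
    unfolding pq using LM d by (intro Dis_rel_mult[OF sub(2) Dis_rel_conj_inv[OF sub(2)]]) auto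
  moreover have "(q \<odot> q') \<odot> inv_Sym (s \<odot> s') =
      (q \<odot> (q' \<odot> inv_Sym s') \<odot> inv_Sym q) \<odot> (q \<odot> inv_Sym s)"
    using S by (simp add: Sym.m_assoc Sym.inv_mult_group)
  moreover have "\<dots> \<in> Dis_rel Q \<alpha>"
    using LM by (intro Dis_rel_mult[OF sub(1) Dis_rel_conj[OF sub(1)]]) auto
  ultimately show ?thesis using LM by (simp add: parallel_def LMlt_mult)
qed

lemma parallel_translations:
  assumes sub: "\<alpha> \<subseteq> carrier Q \<times> carrier Q" "\<beta> \<subseteq> carrier Q \<times> carrier Q"
    and "p = q \<and> r = s \<and> (p, r) \<in> \<alpha> \<or> p = r \<and> q = s \<and> (p, q) \<in> \<beta>"
  shows "parallel \<alpha> \<beta> (L Q p) (L Q q) (L Q r) (L Q s)"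
    and "parallel \<alpha> \<beta> (inv_Sym (L Q p)) (inv_Sym (L Q q)) (inv_Sym (L Q r)) (inv_Sym (L Q s))"
proof -
  have c: "p \<in> carrier Q" "q \<in> carrier Q" "r \<in> carrier Q" "s \<in> carrier Q" using assms by auto
  show "parallel \<alpha> \<beta> (L Q p) (L Q q) (L Q r) (L Q s)"
    using assms c by (auto simp: parallel_def L_in_LMlt L_in_Sym Dis_rel_one
      intro: Dis_rel_quotient Dis_rel_quotient_inv)
  have inv: "inv_Sym (L Q p) \<odot> L Q r \<in> Dis_rel Q \<alpha>" if "(p, r) \<in> \<alpha>"
    using Dis_rel_inv[OF sub(1) Dis_rel_quotient_inv[OF sub(1) that]] c
    by (simp add: L_in_Sym Sym.inv_mult_group)
  have inv': "L Q q \<odot> inv_Sym (L Q p) \<in> Dis_rel Q \<beta>" if "(p, q) \<in> \<beta>"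
    using Dis_rel_inv[OF sub(2) Dis_rel_quotient[OF sub(2) that]] c
    by (simp add: L_in_Sym Sym.inv_mult_group)
  show "parallel \<alpha> \<beta> (inv_Sym (L Q p)) (inv_Sym (L Q q)) (inv_Sym (L Q r)) (inv_Sym (L Q s))"
    using assms c inv inv' by (auto simp: parallel_def L_in_LMlt L_in_Sym Dis_rel_one LMlt_inv)
qed

text \<open>A unary term has a matrix with constant rows if its variable is the distinguished one, and
  with constant columns if its variable is a parameter.\<close>

lemma unary_cases:
  assumes "congruence Q \<alpha>" "congruence Q \<beta>" "(a, b) \<in> \<alpha>" "\<forall>i<n. (u i, v i) \<in> \<beta>"
    and "vars e = {i}" "i \<le> n"
  obtains "eval Q (case_nat a u) e = eval Q (case_nat a v) e"
      "eval Q (case_nat b u) e = eval Q (case_nat b v) e"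
      "(eval Q (case_nat a u) e, eval Q (case_nat b u) e) \<in> \<alpha>"
    | "eval Q (case_nat a u) e = eval Q (case_nat b u) e"
      "eval Q (case_nat a v) e = eval Q (case_nat b v) e"
      "(eval Q (case_nat a u) e, eval Q (case_nat a v) e) \<in> \<beta>"
proof (cases i)
  case 0
  then show ?thesis
    using assms by (intro that(1) eval_cong_vars eval_related[OF assms(1)]) auto
next
  case (Suc j)
  then show ?thesis
    using assms by (intro that(2) eval_cong_vars eval_related[OF assms(2)]) auto
qed

text \<open>The innermost unary term \<open>e\<close> of an lt-term is kept apart: it is the point to which the product of
  translations is applied.\<close>

lemma lt_term_parallel:
  assumes cong: "congruence Q \<alpha>" "congruence Q \<beta>"
    and comm: "\<And>f g. f \<in> Dis_rel Q \<alpha> \<Longrightarrow> g \<in> Dis_rel Q \<beta> \<Longrightarrow> f \<odot> g = g \<odot> f"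
    and ab: "(a, b) \<in> \<alpha>" and uv: "\<forall>i<n. (u i, v i) \<in> \<beta>"
    and "lt_term t" "vars t \<subseteq> {..n}"
  shows "\<exists>p q r s e i. parallel \<alpha> \<beta> p q r s \<and> vars e = {i} \<and> i \<le> n \<and>
    eval Q (case_nat a u) t = p (eval Q (case_nat a u) e) \<and>
    eval Q (case_nat a v) t = q (eval Q (case_nat a v) e) \<and>
    eval Q (case_nat b u) t = r (eval Q (case_nat b u) e) \<and>
    eval Q (case_nat b v) t = s (eval Q (case_nat b v) e)"
  using assms(6,7)
proof induction
  note sub = congruence_subset[OF cong(1)] congruence_subset[OF cong(2)]
  have in_Q: "eval Q (case_nat a u) e \<in> carrier Q \<and> eval Q (case_nat a v) e \<in> carrier Q \<and>
      eval Q (case_nat b u) e \<in> carrier Q \<and> eval Q (case_nat b v) e \<in> carrier Q"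
    if "vars e = {i}" "i \<le> n" for e i
    by (cases rule: unary_cases[OF cong ab uv that]) (use sub in \<open>auto dest: subsetD\<close>)
  have cases: "eval Q (case_nat a u) e = eval Q (case_nat a v) e \<and>
      eval Q (case_nat b u) e = eval Q (case_nat b v) e \<and>
      (eval Q (case_nat a u) e, eval Q (case_nat b u) e) \<in> \<alpha> \<or>
      eval Q (case_nat a u) e = eval Q (case_nat b u) e \<and>
      eval Q (case_nat a v) e = eval Q (case_nat b v) e \<and>
      (eval Q (case_nat a u) e, eval Q (case_nat a v) e) \<in> \<beta>"
    if "vars e = {i}" "i \<le> n" for e i
    by (cases rule: unary_cases[OF cong ab uv that]) simp_all
  {
    case (lt_unary s i)
    have "parallel \<alpha> \<beta> \<one>\<^bsub>Sym Q\<^esub> \<one>\<^bsub>Sym Q\<^esub> \<one>\<^bsub>Sym Q\<^esub> \<one>\<^bsub>Sym Q\<^esub>"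
      by (simp add: parallel_def LMlt_one Dis_rel_one sub)
    moreover have "i \<le> n" using lt_unary by auto
    ultimately show ?case
      using lt_unary(1) in_Q[OF lt_unary(1)] by (metis Sym_one_apply)
  next
    case (lt_Mul c i t)
    then obtain p q r s e j where IH: "parallel \<alpha> \<beta> p q r s" "vars e = {j}" "j \<le> n"
      "eval Q (case_nat a u) t = p (eval Q (case_nat a u) e)"
      "eval Q (case_nat a v) t = q (eval Q (case_nat a v) e)"
      "eval Q (case_nat b u) t = r (eval Q (case_nat b u) e)"
      "eval Q (case_nat b v) t = s (eval Q (case_nat b v) e)"
      by auto
    have i: "vars c = {i}" "i \<le> n" using lt_Mul by auto
    have S: "p \<in> carrier (Sym Q)" "q \<in> carrier (Sym Q)" "r \<in> carrier (Sym Q)" "s \<in> carrier (Sym Q)"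
      using IH(1) LMlt_carrier by (auto simp: parallel_def)
    note P = parallel_mult[OF sub comm parallel_translations(1)[OF sub cases[OF i]] IH(1), simplified]
    show ?case
      by (rule exI conjI P IH(2,3))+
        (use in_Q[OF i] in_Q[OF IH(2,3)] S IH(4-) in
          \<open>simp add: Sym_mult_apply L_in_Sym L_apply Sym_apply\<close>)+
  next
    case (lt_Div c i t)
    then obtain p q r s e j where IH: "parallel \<alpha> \<beta> p q r s" "vars e = {j}" "j \<le> n"
      "eval Q (case_nat a u) t = p (eval Q (case_nat a u) e)"
      "eval Q (case_nat a v) t = q (eval Q (case_nat a v) e)"
      "eval Q (case_nat b u) t = r (eval Q (case_nat b u) e)"
      "eval Q (case_nat b v) t = s (eval Q (case_nat b v) e)"
      by auto
    have i: "vars c = {i}" "i \<le> n" using lt_Div by auto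
    have S: "p \<in> carrier (Sym Q)" "q \<in> carrier (Sym Q)" "r \<in> carrier (Sym Q)" "s \<in> carrier (Sym Q)"
      using IH(1) LMlt_carrier by (auto simp: parallel_def)
    note P = parallel_mult[OF sub comm parallel_translations(2)[OF sub cases[OF i]] IH(1), simplified]
    show ?case
      by (rule exI conjI P IH(2,3))+
        (use in_Q[OF i] in_Q[OF IH(2,3)] S IH(4-) in
          \<open>simp add: Sym_mult_apply L_in_Sym inv_L_apply Sym_apply\<close>)+
  }
qed

text \<open>The common row quotient $g$ of the product of translations must map \<open>e\<close> at $(b,u)$ to \<open>e\<close> at
  $(b,v)$. If \<open>e\<close> depends on the distinguished variable, this is semiregularity; if \<open>e\<close> depends
  on a parameter, it is the hypothesis on the top row.\<close>

lemma commute_semiregular_imp_centralizes: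
  assumes "ltt Q" and cong: "congruence Q \<alpha>" "congruence Q \<beta>"
    and comm: "\<And>f g. f \<in> Dis_rel Q \<alpha> \<Longrightarrow> g \<in> Dis_rel Q \<beta> \<Longrightarrow> f \<odot> g = g \<odot> f"
    and semi: "semiregular \<alpha> (subgroup_of (Sym Q) (Dis_rel Q \<beta>)) (carrier Q) (\<lambda>g. g)"
  shows "centralizes Q \<alpha> \<beta> (Id_on (carrier Q))"
  unfolding centralizes_def
proof (intro allI impI)
  note sub = congruence_subset[OF cong(1)] congruence_subset[OF cong(2)]
  fix n t a b u v
  assume t: "vars t \<subseteq> {..n}" and ab: "(a, b) \<in> \<alpha>" and uv: "\<forall>i<n. (u i, v i) \<in> \<beta>"
    and eq: "(eval Q (case_nat a u) t, eval Q (case_nat a v) t) \<in> Id_on (carrier Q)"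
  obtain w where w: "lt_term w" "vars w \<subseteq> {..n}"
    "\<And>\<rho>. (\<And>i. i \<le> n \<Longrightarrow> \<rho> i \<in> carrier Q) \<Longrightarrow> eval Q \<rho> t = eval Q \<rho> w"
    using assms(1) t unfolding ltt_def by (metis lessThan_Suc_atMost less_Suc_eq_le)
  have "a \<in> carrier Q" "b \<in> carrier Q" "\<And>j. Suc j \<le> n \<Longrightarrow> u j \<in> carrier Q \<and> v j \<in> carrier Q"
    using ab uv sub by (auto simp: Suc_le_eq)
  then have [simp]: "eval Q (case_nat x y) t = eval Q (case_nat x y) w"
    if "x \<in> {a, b}" "y \<in> {u, v}" for x y
    using that by (intro w(3)) (auto split: nat.split)
  obtain p q r s e i where P: "parallel \<alpha> \<beta> p q r s" and e: "vars e = {i}" "i \<le> n"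
    and ev: "eval Q (case_nat a u) w = p (eval Q (case_nat a u) e)"
      "eval Q (case_nat a v) w = q (eval Q (case_nat a v) e)"
      "eval Q (case_nat b u) w = r (eval Q (case_nat b u) e)"
      "eval Q (case_nat b v) w = s (eval Q (case_nat b v) e)"
    using lt_term_parallel[OF cong comm ab uv w(1,2)] by blast
  have S: "p \<in> carrier (Sym Q)" "q \<in> carrier (Sym Q)" "r \<in> carrier (Sym Q)" "s \<in> carrier (Sym Q)"
    using P LMlt_carrier by (auto simp: parallel_def)
  define g where "g = inv_Sym q \<odot> p"
  have g: "g \<in> Dis_rel Q \<beta>" "g = inv_Sym s \<odot> r" using P by (auto simp: parallel_def g_def)
  have g_p: "q (g x) = p x" if "x \<in> carrier Q" for x
    using that S by (simp add: g_def Sym_mult_apply Sym_inv_apply Sym_apply)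
  have g_r: "s (g x) = r x" if "x \<in> carrier Q" for x
    using that S by (simp add: g(2) Sym_mult_apply Sym_inv_apply Sym_apply)
  have pq: "p (eval Q (case_nat a u) e) = q (eval Q (case_nat a v) e)"
    using eq ev by auto
  have "r (eval Q (case_nat b u) e) = s (eval Q (case_nat b v) e) \<and> eval Q (case_nat b v) e \<in> carrier Q"
  proof (cases rule: unary_cases[OF cong ab uv e])
    case 1
    let ?x = "eval Q (case_nat a u) e" and ?y = "eval Q (case_nat b u) e"
    have c: "?x \<in> carrier Q" "?y \<in> carrier Q" using 1 sub by auto
    have "q (g ?x) = q ?x" using pq 1 c g_p by simp
    then have "g ?x = ?x"
      using Sym_injD[OF S(2)] c Sym_apply[OF Dis_rel_carrier[OF sub(2) g(1)]] by simp
    then have "g ?y = ?y"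
      by (intro semiregularD[OF semi _ c(1) _ congruence_sym[OF cong(1) 1(3)]]) (use g(1) in simp)
    then show ?thesis using g_r[OF c(2)] 1 c by simp
  next
    case 2
    let ?x = "eval Q (case_nat a u) e" and ?y = "eval Q (case_nat a v) e"
    have c: "?x \<in> carrier Q" "?y \<in> carrier Q" using 2 sub by auto
    have "q (g ?x) = q ?y" using pq c g_p by simp
    then have "g ?x = ?y"
      using Sym_injD[OF S(2)] c Sym_apply[OF Dis_rel_carrier[OF sub(2) g(1)]] by simp
    then show ?thesis using g_r[OF c(1)] 2 c by simp
  qed
  then show "(eval Q (case_nat b u) t, eval Q (case_nat b v) t) \<in> Id_on (carrier Q)"
    using ev Sym_apply[OF S(4)] by (auto intro: Id_onI)
qed

theorem centralizes_iff:
  assumes "ltt Q" "congruence Q \<alpha>" "congruence Q \<beta>"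
  shows "centralizes Q \<alpha> \<beta> (Id_on (carrier Q)) \<longleftrightarrow>
    (\<forall>f\<in>Dis_rel Q \<alpha>. \<forall>g\<in>Dis_rel Q \<beta>. f \<odot> g = g \<odot> f) \<and>
    semiregular \<alpha> (subgroup_of (Sym Q) (Dis_rel Q \<beta>)) (carrier Q) (\<lambda>g. g)"
  using assms centralizes_imp_commute centralizes_imp_semiregular
    commute_semiregular_imp_centralizes by metis

lemma congruence_full: "congruence Q (carrier Q \<times> carrier Q)"
  by (auto simp: congruence_def equiv_def refl_on_def sym_def trans_def lmul_closed ldiv_closed)

lemma comm_group_Dis_rel:
  assumes "\<theta> \<subseteq> carrier Q \<times> carrier Q"
  shows "comm_group (subgroup_of (Sym Q) (Dis_rel Q \<theta>)) \<longleftrightarrow>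
    (\<forall>f\<in>Dis_rel Q \<theta>. \<forall>g\<in>Dis_rel Q \<theta>. f \<odot> g = g \<odot> f)"
proof
  assume "comm_group (subgroup_of (Sym Q) (Dis_rel Q \<theta>))"
  then interpret comm_group "subgroup_of (Sym Q) (Dis_rel Q \<theta>)" .
  show "\<forall>f\<in>Dis_rel Q \<theta>. \<forall>g\<in>Dis_rel Q \<theta>. f \<odot> g = g \<odot> f" using m_comm by simp
next
  assume *: "\<forall>f\<in>Dis_rel Q \<theta>. \<forall>g\<in>Dis_rel Q \<theta>. f \<odot> g = g \<odot> f"
  show "comm_group (subgroup_of (Sym Q) (Dis_rel Q \<theta>))"
    using * by (intro group.group_comm_groupI[OF subgroup.subgroup_is_group])
      (auto intro: subgroup_Dis_rel[OF assms] Sym.group_axioms)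
qed

lemma Dis_rel_central:
  assumes "\<theta> \<subseteq> carrier Q \<times> carrier Q"
  shows "Dis_rel Q \<theta> \<subseteq> group_center (subgroup_of (Sym Q) (Dis Q)) \<longleftrightarrow>
    (\<forall>f\<in>Dis_rel Q \<theta>. \<forall>g\<in>Dis Q. f \<odot> g = g \<odot> f)"
proof -
  have "Dis_rel Q \<theta> \<subseteq> Dis Q"
    unfolding Dis_def Dis_rel_def using assms by (intro Sym.mono_generate) blast
  then show ?thesis by (auto simp: group_center_def)
qed

end

theorem theorem1p1:
  fixes Q :: "('a, 'b) lquasigroup_scheme" and \<alpha> :: "('a \<times> 'a) set"
  assumes "left_quasigroup Q" and "ltt Q" and "congruence Q \<alpha>"
  shows "(abelian_congruence Q \<alpha> \<longleftrightarrow>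
           comm_group (subgroup_of (Sym Q) (Dis_rel Q \<alpha>)) \<and>
           semiregular \<alpha> (subgroup_of (Sym Q) (Dis_rel Q \<alpha>)) (carrier Q) (\<lambda>g. g)) \<and>
         (central_congruence Q \<alpha> \<longleftrightarrow>
           Dis_rel Q \<alpha> \<subseteq> group_center (subgroup_of (Sym Q) (Dis Q)) \<and>
           semiregular \<alpha> (subgroup_of (Sym Q) (Dis Q)) (carrier Q) (\<lambda>g. g))"
proof -
  interpret left_quasigroup Q by (rule assms(1))
  show ?thesis
    unfolding abelian_congruence_def central_congruence_def
      comm_group_Dis_rel[OF congruence_subset[OF assms(3)]]
      Dis_rel_central[OF congruence_subset[OF assms(3)]]
      centralizes_iff[OF assms(2,3,3)] centralizes_iff[OF assms(2,3) congruence_full]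
    by (simp add: Dis_def)
qed

end
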